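(* Let $\Omega\subset\mathbb{R}^d$ be open and bounded, $Y$ a real Hilbert space, $y\in Y$, $m\in\{0,1\}$, $c>0$, $\lambda=1/c$. Let $A:L^1(\Omega)\to Y$ be a bounded linear operator such that, for some $\gamma>0$, $$\|Au-Av\|\le\gamma\sqrt{d(u,v)}\quad\text{for all }u,v\in\mathrm{dom}(f+\chi_m),$$ and such that $D(u,v)\ge0$ for all $u\in\mathrm{dom}(f+\chi_m)$ and $v\in\mathrm{dom}(f+\chi_m)\cap\mathrm{dom}\,\partial f$. Assume that $Au=y$ has a positive solution $z$, with $\chi_m(z)=0$ if $m=1$. Let $u_0\in\mathrm{dom}\,\partial f$ be an arbitrary starting element with $1+\ln u_0\in\mathcal{R}(A^* )$ and, if $m=1$, $\chi_m(u_0)=0$. Let $\{u_k\}_{k\in\mathbb{N}}$ be generated by $$u_{k+1}=u_k\,c_k^m\,e^{\lambda A^*(y-Au_k)},\qquad c_k^0=1,\qquad c_k^1=\frac{1}{\int_\Omega u_k\,e^{\lambda A^*(y-Au_k)}\,dt},\qquad k=0,1,2,\dots$$ Additionally, let the source condition $1+\ln z\in\mathcal{R}(A^* )$ hold. Then $$d(z,u_k)=O(1/k)\quad\text{as }k\to\infty.$$ Moreover, $\|u_k-z\|_{L^1(\Omega)}=O(1/\sqrt{k})$ if $m=1$.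
   Context: $f:L^1(\Omega)\to(-\infty,+\infty]$ is the negative Boltzmann-Shannon entropy: $f(u)=\int_\Omega u(t)\ln u(t)\,dt$ if $u\ge 0$ a.e. and $u\ln u\in L^1(\Omega)$, and $f(u)=+\infty$ otherwise (with $0\ln 0=0$). $\mathrm{dom}\,f=\{u\in L^1(\Omega): f(u)<\infty\}$. $\mathrm{dom}\,\partial f$ denotes the set of $u\in L^1(\Omega)$ that are (nonnegative,) essentially bounded and bounded away from zero a.e., i.e. $0<\alpha\le u\le\beta<\infty$ a.e. for some constants $\alpha,\beta$. For $v,u\in\mathrm{dom}\,f$ the Kullback-Leibler divergence is $d(v,u)=\int_\Omega\big[v(t)\ln\frac{v(t)}{u(t)}-v(t)+u(t)\big]dt\in[0,+\infty]$ (with $0\ln\frac{0}{s}=0$ for $s\ge0$ and $s\ln\frac{s}{0}=+\infty$ for $s>0$). $\chi_0\equiv 0$; $\chi_1(u)=0$ if $\int_\Omega u(t)\,dt=1$ and $\chi_1(u)=+\infty$ otherwise; $\mathrm{dom}(f+\chi_m)=\{u: f(u)+\chi_m(u)<\infty\}$. $D(u,v)=c\,d(u,v)-\frac12\|Au-Av\|^2$. $A^*:Y\to L^\infty(\Omega)$ is the adjoint of $A$ (identifying $Y^*$ with $Y$) and $\mathcal{R}(A^* )$ its range. (The nonnegativity of $D$ holds e.g. if $c\ge\gamma^2/2$.) The iterates are well defined and belong to $\mathrm{dom}\,\partial f$. *)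

theory Defs
  imports "HOL-Analysis.Analysis" "HOL-Library.Landau_Symbols"
begin

text \<open>
  Elements of \<open>L\<^sup>1(\<Omega>)\<close> and \<open>L\<^sup>\<infinity>(\<Omega>)\<close> are represented by functions on \<open>\<real>\<^sup>d\<close>; all
  notions below look only at their values on \<open>\<Omega>\<close> and are invariant under modification on
  a Lebesgue null set.
\<close>

definition L1 :: "(real^'d) set \<Rightarrow> (real^'d \<Rightarrow> real) set" where
  "L1 \<Omega> = {u. integrable (lebesgue_on \<Omega>) u}"

definition L1_norm :: "(real^'d) set \<Rightarrow> (real^'d \<Rightarrow> real) \<Rightarrow> real" where
  "L1_norm \<Omega> u = (LINT t|lebesgue_on \<Omega>. \<bar>u t\<bar>)"

definition Linf :: "(real^'d) set \<Rightarrow> (real^'d \<Rightarrow> real) set" where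
  "Linf \<Omega> = {g. g \<in> borel_measurable (lebesgue_on \<Omega>) \<and> (\<exists>B. AE t in lebesgue_on \<Omega>. \<bar>g t\<bar> \<le> B)}"

text \<open>
  Bounded linear operators \<open>L\<^sup>1(\<Omega>) \<rightarrow> Y\<close>. Since \<open>L1_norm \<Omega> (u - v) = 0\<close> when \<open>u = v\<close> a.e.,
  such an operator is automatically well defined on equivalence classes.
\<close>

definition bounded_linear_L1 :: "(real^'d) set \<Rightarrow> ((real^'d \<Rightarrow> real) \<Rightarrow> 'y::real_normed_vector) \<Rightarrow> bool" where
  "bounded_linear_L1 \<Omega> A \<longleftrightarrow>
     (\<forall>u\<in>L1 \<Omega>. \<forall>v\<in>L1 \<Omega>. A (\<lambda>t. u t + v t) = A u + A v) \<and>
     (\<forall>r. \<forall>u\<in>L1 \<Omega>. A (\<lambda>t. r * u t) = r *\<^sub>R A u) \<and>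
     (\<exists>K. \<forall>u\<in>L1 \<Omega>. norm (A u) \<le> K * L1_norm \<Omega> u)"

text \<open>
  A representative of \<open>A\<^sup>* w \<in> L\<^sup>\<infinity>(\<Omega>)\<close>, with \<open>Y\<^sup>*\<close> identified with \<open>Y\<close>. It exists and is
  unique up to null sets, see \<open>adjoint_L1_in_Linf\<close>, \<open>adjoint_L1_inner\<close> and
  \<open>adjoint_L1_unique\<close>.
\<close>

definition adjoint_L1 ::
  "(real^'d) set \<Rightarrow> ((real^'d \<Rightarrow> real) \<Rightarrow> 'y::real_inner) \<Rightarrow> 'y \<Rightarrow> real^'d \<Rightarrow> real" where
  "adjoint_L1 \<Omega> A w =
     (SOME g. g \<in> Linf \<Omega> \<and> (\<forall>u\<in>L1 \<Omega>. (LINT t|lebesgue_on \<Omega>. g t * u t) = A u \<bullet> w))"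

definition range_adjoint_L1 ::
  "(real^'d) set \<Rightarrow> ((real^'d \<Rightarrow> real) \<Rightarrow> 'y::real_inner) \<Rightarrow> (real^'d \<Rightarrow> real) set" where
  "range_adjoint_L1 \<Omega> A = {g. \<exists>w. AE t in lebesgue_on \<Omega>. g t = adjoint_L1 \<Omega> A w t}"

definition neg_entropy :: "(real^'d) set \<Rightarrow> (real^'d \<Rightarrow> real) \<Rightarrow> ereal" where
  "neg_entropy \<Omega> u =
     (if (AE t in lebesgue_on \<Omega>. 0 \<le> u t) \<and> (\<lambda>t. u t * ln (u t)) \<in> L1 \<Omega>
      then ereal (LINT t|lebesgue_on \<Omega>. u t * ln (u t)) else \<infinity>)"

definition mass_indicator :: "(real^'d) set \<Rightarrow> nat \<Rightarrow> (real^'d \<Rightarrow> real) \<Rightarrow> ereal" where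
  "mass_indicator \<Omega> m u = (if m = 0 \<or> (LINT t|lebesgue_on \<Omega>. u t) = 1 then 0 else \<infinity>)"

definition dom_f_chi :: "(real^'d) set \<Rightarrow> nat \<Rightarrow> (real^'d \<Rightarrow> real) set" where
  "dom_f_chi \<Omega> m = {u \<in> L1 \<Omega>. neg_entropy \<Omega> u + mass_indicator \<Omega> m u < \<infinity>}"

definition dom_subdiff :: "(real^'d) set \<Rightarrow> (real^'d \<Rightarrow> real) set" where
  "dom_subdiff \<Omega> =
     {u \<in> L1 \<Omega>. \<exists>\<alpha> \<beta>. 0 < \<alpha> \<and> (AE t in lebesgue_on \<Omega>. \<alpha> \<le> u t \<and> u t \<le> \<beta>)}"

text \<open>
  The integrand of the Kullback-Leibler divergence, for \<open>a, b \<ge> 0\<close>. The value at \<open>a = 0\<close> is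
  \<open>b\<close>, because \<open>0 * ln (0 / b) = 0\<close> in HOL. It is nonnegative by \<open>kl_integrand_nonneg\<close>, so
  that passing to \<open>ennreal\<close> truncates nothing.
\<close>

definition kl_integrand :: "real \<Rightarrow> real \<Rightarrow> ennreal" where
  "kl_integrand a b = (if 0 < a \<and> b = 0 then \<infinity> else ennreal (a * ln (a / b) - a + b))"

definition kl_div :: "(real^'d) set \<Rightarrow> (real^'d \<Rightarrow> real) \<Rightarrow> (real^'d \<Rightarrow> real) \<Rightarrow> ereal" where
  "kl_div \<Omega> v u = enn2ereal (\<integral>\<^sup>+t. kl_integrand (v t) (u t) \<partial>lebesgue_on \<Omega>)"

definition sqrt_ereal :: "ereal \<Rightarrow> ereal" where
  "sqrt_ereal x = (if x = \<infinity> then \<infinity> else ereal (sqrt (real_of_ereal x)))"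

definition D_functional ::
  "(real^'d) set \<Rightarrow> ((real^'d \<Rightarrow> real) \<Rightarrow> 'y::real_normed_vector) \<Rightarrow> real \<Rightarrow>
     (real^'d \<Rightarrow> real) \<Rightarrow> (real^'d \<Rightarrow> real) \<Rightarrow> ereal" where
  "D_functional \<Omega> A c u v = ereal c * kl_div \<Omega> u v - ereal ((norm (A u - A v))\<^sup>2 / 2)"

definition exp_step ::
  "(real^'d) set \<Rightarrow> ((real^'d \<Rightarrow> real) \<Rightarrow> 'y::real_inner) \<Rightarrow> 'y \<Rightarrow> real \<Rightarrow>
     (real^'d \<Rightarrow> real) \<Rightarrow> real^'d \<Rightarrow> real" where
  "exp_step \<Omega> A y lam u t = u t * exp (lam * adjoint_L1 \<Omega> A (y - A u) t)"

definition step_factor ::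
  "(real^'d) set \<Rightarrow> ((real^'d \<Rightarrow> real) \<Rightarrow> 'y::real_inner) \<Rightarrow> 'y \<Rightarrow> real \<Rightarrow> nat \<Rightarrow>
     (real^'d \<Rightarrow> real) \<Rightarrow> real" where
  "step_factor \<Omega> A y lam m u =
     (if m = 0 then 1 else 1 / (LINT t|lebesgue_on \<Omega>. exp_step \<Omega> A y lam u t))"

lemma kl_integrand_nonneg:
  fixes a b :: real
  assumes "0 \<le> a" "0 \<le> b" "\<not> (0 < a \<and> b = 0)"
  shows "0 \<le> a * ln (a / b) - a + b"
proof (cases "a = 0")
  case True
  with assms show ?thesis by simp
next
  case False
  with assms have ab: "0 < a" "0 < b" by auto
  have "ln (b / a) \<le> b / a - 1"
    using ab by (intro ln_le_minus_one) simp
  moreover have "ln (a / b) = - ln (b / a)"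
    using ab by (simp add: ln_div)
  ultimately have "1 - b / a \<le> ln (a / b)" by linarith
  then have "a * (1 - b / a) \<le> a * ln (a / b)"
    using ab by (intro mult_left_mono) auto
  moreover have "a * (1 - b / a) = a - b"
    using ab by (simp add: field_simps)
  ultimately show ?thesis by linarith
qed

text \<open>Bounded functionals on \<open>L\<^sup>1\<close> of a finite measure are represented by bounded functions.\<close>

lemma (in finite_measure) L1_functional_representation:
  fixes T :: "('a \<Rightarrow> real) \<Rightarrow> real"
  assumes add: "\<And>u v. integrable M u \<Longrightarrow> integrable M v \<Longrightarrow> T (\<lambda>x. u x + v x) = T u + T v"
    and scale: "\<And>r u. integrable M u \<Longrightarrow> T (\<lambda>x. r * u x) = r * T u"
    and bnd: "\<And>u. integrable M u \<Longrightarrow> \<bar>T u\<bar> \<le> K * (LINT x|M. \<bar>u x\<bar>)"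
    and K: "0 \<le> K"
  shows "\<exists>g. g \<in> borel_measurable M \<and> (\<exists>B. AE x in M. \<bar>g x\<bar> \<le> B) \<and>
           (\<forall>u. integrable M u \<longrightarrow> (LINT x|M. g x * u x) = T u)"
proof -
  have int_ind: "integrable M (indicator E :: 'a \<Rightarrow> real)" if "E \<in> sets M" for E
    using that by (simp add: integrable_indicator_iff less_top[symmetric])
  define h where "h E = K * measure M E + T (indicator E)" for E
  have T_ind: "\<bar>T (indicator E)\<bar> \<le> K * measure M E" if "E \<in> sets M" for E
    using bnd[OF int_ind[OF that]] that by simp
  have h_bnds: "0 \<le> h E" "h E \<le> 2 * K * measure M E" if "E \<in> sets M" for E
    using T_ind[OF that] unfolding h_def by linarith+
  have h_add: "h (E \<union> F) = h E + h F" if "E \<in> sets M" "F \<in> sets M" "E \<inter> F = {}" for E F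
  proof -
    have "(indicator (E \<union> F) :: 'a \<Rightarrow> real) = (\<lambda>x. indicator E x + indicator F x)"
      using that by (auto simp: fun_eq_iff indicator_def)
    then have "T (indicator (E \<union> F)) = T (indicator E) + T (indicator F)"
      using add[OF int_ind[OF that(1)] int_ind[OF that(2)]] by simp
    then show ?thesis
      using that by (simp add: h_def finite_measure_Union algebra_simps)
  qed
  define N where "N = measure_of (space M) (sets M) (\<lambda>E. ennreal (h E))"
  have pos: "positive (sets M) (\<lambda>E. ennreal (h E))"
    using h_bnds(1)[of "{}"] h_bnds(2)[of "{}"] by (auto simp: positive_def)
  have ca: "countably_additive (sets M) (\<lambda>E. ennreal (h E))"
  proof (rule sets.empty_continuous_imp_countably_additive[OF pos])
    show "additive (sets M) (\<lambda>E. ennreal (h E))"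
      unfolding additive_def
    proof (intro ballI impI)
      fix E F assume EF: "E \<in> sets M" "F \<in> sets M" "E \<inter> F = {}"
      show "ennreal (h (E \<union> F)) = ennreal (h E) + ennreal (h F)"
        using h_add[OF EF] h_bnds(1)[OF EF(1)] h_bnds(1)[OF EF(2)] by (simp add: ennreal_plus)
    qed
    show "\<forall>A\<in>sets M. ennreal (h A) \<noteq> \<infinity>" by simp
    fix A :: "nat \<Rightarrow> 'a set" assume A: "range A \<subseteq> sets M" "decseq A" "(\<Inter>i. A i) = {}"
    then have "(\<lambda>i. measure M (A i)) \<longlonglongrightarrow> measure M {}"
      using finite_Lim_measure_decseq[of A] by simp
    then have lim: "(\<lambda>i. 2 * K * measure M (A i)) \<longlonglongrightarrow> 0"
      using tendsto_mult_left[of _ 0 _ "2 * K"] by simp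
    have "(\<lambda>i. h (A i)) \<longlonglongrightarrow> 0"
      by (rule tendsto_sandwich[OF _ _ tendsto_const lim])
         (use A(1) h_bnds in auto)
    then show "(\<lambda>i. ennreal (h (A i))) \<longlonglongrightarrow> 0"
      using tendsto_ennrealI by fastforce
  qed
  have sets_N [measurable_cong, simp]: "sets N = sets M" and space_N: "space N = space M"
    unfolding N_def by auto
  have em_N: "emeasure N E = ennreal (h E)" if "E \<in> sets M" for E
    unfolding N_def using pos ca that by (intro emeasure_measure_of_sigma) (auto simp: sets.sigma_algebra_axioms)
  have ac: "absolutely_continuous M N"
    unfolding absolutely_continuous_def
  proof
    fix E assume E: "E \<in> null_sets M"
    then have "measure M E = 0" "E \<in> sets M" by (auto simp: null_sets_def measure_def)
    then have "h E = 0" using h_bnds[of E] by simp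
    then show "E \<in> null_sets N" using em_N E by (auto simp: null_sets_def)
  qed
  obtain f where f [measurable]: "f \<in> borel_measurable M" and dens: "density M f = N"
    using Radon_Nikodym[OF ac sets_N] by blast
  have nn_f: "(\<integral>\<^sup>+x. f x * indicator E x \<partial>M) = ennreal (h E)" if "E \<in> sets M" for E
    using em_N[OF that] emeasure_density[OF f that] dens by simp
  have f_fin: "AE x in M. f x \<noteq> \<infinity>"
  proof (rule nn_integral_PInf_AE[OF f])
    have "(\<integral>\<^sup>+x. f x \<partial>M) = (\<integral>\<^sup>+x. f x * indicator (space M) x \<partial>M)"
      by (intro nn_integral_cong) auto
    also have "\<dots> = ennreal (h (space M))" by (rule nn_f) simp
    finally show "(\<integral>\<^sup>+x. f x \<partial>M) \<noteq> \<infinity>" by simp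
  qed
  define k where "k x = enn2real (f x)" for x
  have k [measurable]: "k \<in> borel_measurable M" unfolding k_def by measurable
  have k0: "0 \<le> k x" for x by (simp add: k_def)
  have nn_k: "(\<integral>\<^sup>+x. ennreal (k x * indicator E x) \<partial>M) = ennreal (h E)" if "E \<in> sets M" for E
  proof -
    have "(\<integral>\<^sup>+x. ennreal (k x * indicator E x) \<partial>M) = (\<integral>\<^sup>+x. f x * indicator E x \<partial>M)"
      by (rule nn_integral_cong_AE) (use f_fin in \<open>auto simp: k_def indicator_def less_top\<close>)
    then show ?thesis using nn_f[OF that] by simp
  qed
  have k_int: "has_bochner_integral M (\<lambda>x. k x * indicator E x) (h E)" if [measurable]: "E \<in> sets M" for E
    by (rule has_bochner_integral_nn_integral[OF _ _ h_bnds(1)[OF that] nn_k[OF that]])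
       (auto simp: k0)
  have k_bnd: "AE x in M. k x \<le> 2 * K"
  proof -
    define E where "E = {x \<in> space M. 2 * K < k x}"
    have E [measurable]: "E \<in> sets M" unfolding E_def by measurable
    have I: "has_bochner_integral M (\<lambda>x. k x * indicator E x - 2 * K * indicator E x)
               (h E - 2 * K * measure M E)"
      by (intro has_bochner_integral_diff k_int[OF E] has_bochner_integral_mult_right
            has_bochner_integral_real_indicator) (auto simp: less_top[symmetric])
    have nonneg: "0 \<le> k x * indicator E x - 2 * K * indicator E x" for x
      by (auto simp: E_def indicator_def)
    have "(LINT x|M. k x * indicator E x - 2 * K * indicator E x) \<le> 0"
      using has_bochner_integral_integral_eq[OF I] h_bnds(2)[OF E] by simp
    then have "(LINT x|M. k x * indicator E x - 2 * K * indicator E x) = 0"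
      by (intro antisym Bochner_Integration.integral_nonneg nonneg)
    then have "AE x in M. k x * indicator E x - 2 * K * indicator E x = 0"
      using integral_nonneg_eq_0_iff_AE[OF integrable.intros[OF I]] nonneg by auto
    then show ?thesis
      using AE_space by eventually_elim (auto simp: E_def indicator_def split: if_splits)
  qed
  define g where "g x = k x - K" for x
  have g [measurable]: "g \<in> borel_measurable M" unfolding g_def by measurable
  have g_bnd: "AE x in M. \<bar>g x\<bar> \<le> K"
    using k_bnd by eventually_elim (use k0 in \<open>auto simp: g_def abs_le_iff\<close>)
  have gu: "integrable M (\<lambda>x. g x * u x)" if "integrable M u" for u
  proof (rule Bochner_Integration.integrable_bound[of M "\<lambda>x. K * u x"])
    show "integrable M (\<lambda>x. K * u x)" using that by simp
    show "(\<lambda>x. g x * u x) \<in> borel_measurable M"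
      using borel_measurable_integrable[OF that] by measurable
    show "AE x in M. norm (g x * u x) \<le> norm (K * u x)"
      using g_bnd by eventually_elim (use K in \<open>auto simp: abs_mult intro: mult_right_mono\<close>)
  qed
  have rep: "(LINT x|M. g x * u x) = T u" if "integrable M u" for u
    using that
  proof (induction rule: integrable_induct)
    case (base E c)
    have I: "has_bochner_integral M (\<lambda>x. k x * indicator E x - K * indicator E x)
               (h E - K * measure M E)"
      by (intro has_bochner_integral_diff k_int base has_bochner_integral_mult_right
            has_bochner_integral_real_indicator)
    have "(\<lambda>x. g x * (indicator E x *\<^sub>R c)) = (\<lambda>x. (k x * indicator E x - K * indicator E x) * c)"
      by (auto simp: g_def fun_eq_iff algebra_simps)
    then have "(LINT x|M. g x * (indicator E x *\<^sub>R c)) = (h E - K * measure M E) * c"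
      using has_bochner_integral_integral_eq[OF has_bochner_integral_mult_left[OF I, of c]] by simp
    moreover have "T (\<lambda>x. indicator E x *\<^sub>R c) = c * T (indicator E)"
      using scale[OF int_ind[OF base(1)], of c] by (simp add: mult.commute)
    ultimately show ?case by (simp add: h_def mult.commute)
  next
    case (add u v)
    then show ?case
      using assms(1)[of u v] gu[of u] gu[of v] by (simp add: distrib_left)
  next
    case (lim u s)
    have s_int: "integrable M (\<lambda>x. s i x - u x)" for i using lim.hyps by simp
    have abs_lim: "(\<lambda>i. LINT x|M. \<bar>s i x - u x\<bar>) \<longlonglongrightarrow> (LINT x|M. 0)"
    proof (rule integral_dominated_convergence[where w = "\<lambda>x. 3 * \<bar>u x\<bar>"])
      show "(\<lambda>x. 0::real) \<in> borel_measurable M" by simp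
      show "(\<lambda>x. \<bar>s i x - u x\<bar>) \<in> borel_measurable M" for i
        using borel_measurable_integrable[OF s_int[of i]] by measurable
      show "integrable M (\<lambda>x. 3 * \<bar>u x\<bar>)" using lim.hyps(4) by simp
      show "AE x in M. (\<lambda>i. \<bar>s i x - u x\<bar>) \<longlonglongrightarrow> 0"
        using lim.hyps(2) by (intro AE_I2 tendsto_rabs_zero) (simp add: LIM_zero)
      show "AE x in M. norm \<bar>s i x - u x\<bar> \<le> 3 * \<bar>u x\<bar>" for i
      proof (rule AE_I2)
        fix x assume "x \<in> space M"
        from lim.hyps(3)[OF this, of i] show "norm \<bar>s i x - u x\<bar> \<le> 3 * \<bar>u x\<bar>" by simp
      qed
    qed
    then have K_lim: "(\<lambda>i. K * (LINT x|M. \<bar>s i x - u x\<bar>)) \<longlonglongrightarrow> 0"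
      using tendsto_mult_left[of _ 0 _ K] by simp
    have T_diff: "T (s i) - T u = T (\<lambda>x. s i x - u x)" for i
      using assms(1)[OF s_int[of i] lim.hyps(4)] by simp
    have T_lim: "(\<lambda>i. T (s i)) \<longlonglongrightarrow> T u"
    proof (rule LIM_zero_cancel, rule Lim_null_comparison[OF _ K_lim])
      show "\<forall>\<^sub>F i in sequentially. norm (T (s i) - T u) \<le> K * (LINT x|M. \<bar>s i x - u x\<bar>)"
        using bnd[OF s_int] by (simp add: T_diff)
    qed
    have g_diff: "(LINT x|M. g x * s i x) - (LINT x|M. g x * u x) = (LINT x|M. g x * (s i x - u x))" for i
      using gu[OF lim.hyps(1)[of i]] gu[OF lim.hyps(4)] by (simp add: right_diff_distrib)
    have "(\<lambda>i. LINT x|M. g x * s i x) \<longlonglongrightarrow> (LINT x|M. g x * u x)"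
    proof (rule LIM_zero_cancel, rule Lim_null_comparison[OF _ K_lim], rule always_eventually, rule allI)
      fix i
      have "norm (LINT x|M. g x * (s i x - u x)) \<le> (LINT x|M. norm (g x * (s i x - u x)))"
        by (rule integral_norm_bound)
      also have "\<dots> \<le> (LINT x|M. K * \<bar>s i x - u x\<bar>)"
      proof (rule integral_mono_AE)
        show "integrable M (\<lambda>x. norm (g x * (s i x - u x)))"
          by (rule integrable_norm[OF gu[OF s_int]])
        show "integrable M (\<lambda>x. K * \<bar>s i x - u x\<bar>)" using s_int by simp
        show "AE x in M. norm (g x * (s i x - u x)) \<le> K * \<bar>s i x - u x\<bar>"
          using g_bnd by eventually_elim (auto simp: abs_mult intro: mult_right_mono)
      qed
      finally have "norm (LINT x|M. g x * (s i x - u x)) \<le> K * (LINT x|M. \<bar>s i x - u x\<bar>)"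
        by simp
      then show "norm ((LINT x|M. g x * s i x) - (LINT x|M. g x * u x)) \<le> K * (LINT x|M. \<bar>s i x - u x\<bar>)"
        using g_diff by simp
    qed
    then show ?case
      using LIMSEQ_unique T_lim lim.IH by auto
  qed
  show ?thesis using g g_bnd rep by blast
qed

lemma finite_measure_lebesgue_on_bounded:
  fixes \<Omega> :: "(real^'d) set"
  assumes "open \<Omega>" "bounded \<Omega>"
  shows "finite_measure (lebesgue_on \<Omega>)"
proof -
  have "\<Omega> \<in> lmeasurable"
    using assms by (simp add: lmeasurable_open)
  then show ?thesis
    by (rule finite_measure_lebesgue_on)
qed

lemma adjoint_L1_exists:
  fixes \<Omega> :: "(real^'d) set" and A :: "(real^'d \<Rightarrow> real) \<Rightarrow> 'y::real_inner"
  assumes "open \<Omega>" "bounded \<Omega>" "bounded_linear_L1 \<Omega> A"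
  shows "\<exists>g. g \<in> Linf \<Omega> \<and> (\<forall>u\<in>L1 \<Omega>. (LINT t|lebesgue_on \<Omega>. g t * u t) = A u \<bullet> w)"
proof -
  interpret finite_measure "lebesgue_on \<Omega>"
    using assms by (intro finite_measure_lebesgue_on_bounded)
  have A_add: "A (\<lambda>t. u t + v t) = A u + A v" if "u \<in> L1 \<Omega>" "v \<in> L1 \<Omega>" for u v
    using assms(3) that by (auto simp: bounded_linear_L1_def)
  have A_scale: "A (\<lambda>t. r * u t) = r *\<^sub>R A u" if "u \<in> L1 \<Omega>" for r u
    using assms(3) that by (auto simp: bounded_linear_L1_def)
  obtain K where K: "\<And>u. u \<in> L1 \<Omega> \<Longrightarrow> norm (A u) \<le> K * L1_norm \<Omega> u"
    using assms(3) unfolding bounded_linear_L1_def by blast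
  have nn: "0 \<le> L1_norm \<Omega> u" for u
    unfolding L1_norm_def by (intro Bochner_Integration.integral_nonneg) simp
  have bnd: "\<bar>A u \<bullet> w\<bar> \<le> (\<bar>K\<bar> * norm w) * (LINT t|lebesgue_on \<Omega>. \<bar>u t\<bar>)"
    if "integrable (lebesgue_on \<Omega>) u" for u
  proof -
    have "\<bar>A u \<bullet> w\<bar> \<le> norm (A u) * norm w" by (rule Cauchy_Schwarz_ineq2)
    also have "norm (A u) \<le> \<bar>K\<bar> * L1_norm \<Omega> u"
      using K[of u] that mult_right_mono[OF abs_ge_self[of K] nn[of u]] by (simp add: L1_def)
    finally show ?thesis by (simp add: L1_norm_def mult_ac mult_right_mono)
  qed
  show ?thesis
    using L1_functional_representation[of "\<lambda>u. A u \<bullet> w" "\<bar>K\<bar> * norm w", OF _ _ bnd]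
    by (auto simp: L1_def Linf_def A_add A_scale inner_add_left)
qed

lemma adjoint_L1_in_Linf:
  fixes \<Omega> :: "(real^'d) set" and A :: "(real^'d \<Rightarrow> real) \<Rightarrow> 'y::real_inner"
  assumes "open \<Omega>" "bounded \<Omega>" "bounded_linear_L1 \<Omega> A"
  shows "adjoint_L1 \<Omega> A w \<in> Linf \<Omega>"
  using someI_ex[OF adjoint_L1_exists[OF assms, of w]] by (simp add: adjoint_L1_def)

lemma adjoint_L1_inner:
  fixes \<Omega> :: "(real^'d) set" and A :: "(real^'d \<Rightarrow> real) \<Rightarrow> 'y::real_inner"
  assumes "open \<Omega>" "bounded \<Omega>" "bounded_linear_L1 \<Omega> A" "u \<in> L1 \<Omega>"
  shows "(LINT t|lebesgue_on \<Omega>. adjoint_L1 \<Omega> A w t * u t) = A u \<bullet> w"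
  using someI_ex[OF adjoint_L1_exists[OF assms(1-3), of w]] assms(4) by (simp add: adjoint_L1_def)

lemma adjoint_L1_unique:
  fixes \<Omega> :: "(real^'d) set" and A :: "(real^'d \<Rightarrow> real) \<Rightarrow> 'y::real_inner"
  assumes "open \<Omega>" "bounded \<Omega>" "bounded_linear_L1 \<Omega> A" "g \<in> Linf \<Omega>"
    and g: "\<And>u. u \<in> L1 \<Omega> \<Longrightarrow> (LINT t|lebesgue_on \<Omega>. g t * u t) = A u \<bullet> w"
  shows "AE t in lebesgue_on \<Omega>. g t = adjoint_L1 \<Omega> A w t"
proof -
  interpret finite_measure "lebesgue_on \<Omega>"
    using assms by (intro finite_measure_lebesgue_on_bounded)
  let ?a = "adjoint_L1 \<Omega> A w"
  have int: "integrable (lebesgue_on \<Omega>) h" if "h \<in> Linf \<Omega>" for h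
    using that unfolding Linf_def by (auto intro!: integrable_const_bound[where f = h])
  have a: "?a \<in> Linf \<Omega>" by (rule adjoint_L1_in_Linf[OF assms(1-3)])
  show ?thesis
  proof (rule density_unique_real[OF int[OF assms(4)] int[OF a]])
    fix E assume E: "E \<in> sets (lebesgue_on \<Omega>)"
    have "(indicator E :: _ \<Rightarrow> real) \<in> L1 \<Omega>"
      using E sets.Int_space_eq2[OF E] by (simp add: L1_def integrable_indicator_iff less_top[symmetric])
    from g[OF this] adjoint_L1_inner[OF assms(1-3) this]
    show "(LINT t:E|lebesgue_on \<Omega>. g t) = (LINT t:E|lebesgue_on \<Omega>. ?a t)"
      by (simp add: set_lebesgue_integral_def mult.commute)
  qed
qed

end

theory Submission
  imports Defs
begin

text \<open>
  Write \<open>d k\<close> for the divergence of \<open>u k\<close> from \<open>z\<close> and \<open>r k = y - A (u k)\<close>. The three-point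
  identity of the Bregman distance and \<open>D \<ge> 0\<close> give \<open>d (k + 1) + lam / 2 * \<parallel>r k\<parallel>\<^sup>2 \<le> d k\<close>. The
  source conditions write \<open>ln (u k) - ln z\<close>, up to an additive constant that mean-zero
  functions do not see, as the adjoint applied to a dual variable \<open>p k\<close> with
  \<open>p (k + 1) = p k + lam * r k\<close>, and the symmetrised divergence is then \<open>- \<langle>p k, r k\<rangle>\<close>, an upper
  bound for \<open>d k\<close>. Hence \<open>\<parallel>p k\<parallel>\<^sup>2 + 2 * lam * d k\<close> drops by at least \<open>2 * lam * d k\<close> in each
  step; so \<open>d\<close> is summable, and being decreasing it is \<open>O(1/k)\<close>. The \<open>L\<^sup>1\<close> rate follows by an
  inequality of Pinsker type.
\<close>

section \<open>Essentially bounded functions and functions with bounded logarithm\<close>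

definition ess_bdd :: "'a measure \<Rightarrow> ('a \<Rightarrow> real) \<Rightarrow> bool" where
  "ess_bdd M f \<longleftrightarrow> f \<in> borel_measurable M \<and> (\<exists>B. AE t in M. \<bar>f t\<bar> \<le> B)"

text \<open>This encodes \<open>dom_subdiff\<close> through the logarithm, to which the iteration
  merely adds bounded functions. Positivity is demanded separately because \<open>ln\<close> is
  total, so a bounded \<open>ln (u t)\<close> alone does not force it.\<close>

definition ess_pos :: "'a measure \<Rightarrow> ('a \<Rightarrow> real) \<Rightarrow> bool" where
  "ess_pos M u \<longleftrightarrow> ess_bdd M u \<and> ess_bdd M (\<lambda>t. ln (u t)) \<and> (AE t in M. 0 < u t)"

text \<open>Real-valued counterpart of \<open>kl_div\<close>, with the logarithm of the quotient
  split so that the integrand is affine in \<open>ln (u t)\<close>. The two agree for functions in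
  \<open>ess_pos\<close>, see \<open>kl_div_eq_KL\<close>.\<close>

definition KL :: "'a measure \<Rightarrow> ('a \<Rightarrow> real) \<Rightarrow> ('a \<Rightarrow> real) \<Rightarrow> real" where
  "KL M v u = (LINT t|M. v t * (ln (v t) - ln (u t)) - v t + u t)"

lemma ess_bdd_measurable: "ess_bdd M f \<Longrightarrow> f \<in> borel_measurable M"
  by (simp add: ess_bdd_def)

lemma ess_bddI: "f \<in> borel_measurable M \<Longrightarrow> AE t in M. \<bar>f t\<bar> \<le> B \<Longrightarrow> ess_bdd M f"
  by (auto simp: ess_bdd_def)

lemma ess_bddE:
  assumes "ess_bdd M f"
  obtains B where "AE t in M. \<bar>f t\<bar> \<le> B"
  using assms by (auto simp: ess_bdd_def)

lemma ess_bdd_const: "ess_bdd M (\<lambda>t. r)"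
  by (rule ess_bddI[where B = "\<bar>r\<bar>"]) auto

lemma ess_bdd_add:
  assumes "ess_bdd M f" "ess_bdd M g"
  shows "ess_bdd M (\<lambda>t. f t + g t)"
proof -
  obtain B C where "AE t in M. \<bar>f t\<bar> \<le> B" "AE t in M. \<bar>g t\<bar> \<le> C"
    using assms by (metis ess_bddE)
  then have "AE t in M. \<bar>f t + g t\<bar> \<le> B + C"
    by eventually_elim linarith
  then show ?thesis
    using assms[THEN ess_bdd_measurable] by (intro ess_bddI) auto
qed

lemma ess_bdd_mult:
  assumes "ess_bdd M f" "ess_bdd M g"
  shows "ess_bdd M (\<lambda>t. f t * g t)"
proof -
  obtain B C where "AE t in M. \<bar>f t\<bar> \<le> B" "AE t in M. \<bar>g t\<bar> \<le> C"
    using assms by (metis ess_bddE)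
  then have "AE t in M. \<bar>f t * g t\<bar> \<le> B * C"
    by eventually_elim (auto simp: abs_mult intro!: mult_mono)
  then show ?thesis
    using assms[THEN ess_bdd_measurable] by (intro ess_bddI) auto
qed

lemma ess_bdd_diff:
  assumes "ess_bdd M f" "ess_bdd M g"
  shows "ess_bdd M (\<lambda>t. f t - g t)"
  using ess_bdd_add[OF assms(1) ess_bdd_mult[OF ess_bdd_const[of M "-1"] assms(2)]] by simp

lemma ess_bdd_exp:
  assumes "ess_bdd M f"
  shows "ess_bdd M (\<lambda>t. exp (f t))"
proof -
  obtain B where "AE t in M. \<bar>f t\<bar> \<le> B" using assms by (rule ess_bddE)
  then have "AE t in M. \<bar>exp (f t)\<bar> \<le> exp B"
    by eventually_elim auto
  then show ?thesis
    using assms[THEN ess_bdd_measurable] by (intro ess_bddI) auto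
qed

lemma ess_bdd_cong_AE:
  assumes "ess_bdd M f" "AE t in M. g t = f t" "g \<in> borel_measurable M"
  shows "ess_bdd M g"
proof -
  obtain B where "AE t in M. \<bar>f t\<bar> \<le> B" using assms(1) by (rule ess_bddE)
  with assms(2) have "AE t in M. \<bar>g t\<bar> \<le> B"
    by eventually_elim simp
  then show ?thesis using assms(3) by (rule ess_bddI[rotated])
qed

lemmas ess_bdd_intros = ess_bdd_const ess_bdd_add ess_bdd_mult ess_bdd_diff ess_bdd_exp

lemma (in finite_measure) integrable_ess_bdd: "ess_bdd M f \<Longrightarrow> integrable M f"
  using integrable_const_bound[of f] by (auto simp: ess_bdd_def)

lemma ess_posD:
  assumes "ess_pos M u"
  shows "ess_bdd M u" "ess_bdd M (\<lambda>t. ln (u t))" "AE t in M. 0 < u t"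
  using assms by (auto simp: ess_pos_def)

text \<open>Almost everywhere \<open>u t = exp (f t)\<close>, so a bound on the logarithm already
  bounds \<open>u\<close> itself.\<close>

lemma ess_pos_if_ln:
  assumes "u \<in> borel_measurable M" "AE t in M. 0 < u t" "ess_bdd M f" "AE t in M. ln (u t) = f t"
  shows "ess_pos M u"
proof -
  have "AE t in M. u t = exp (f t)"
    using assms(2,4) by eventually_elim (metis exp_ln)
  from ess_bdd_cong_AE[OF ess_bdd_exp[OF assms(3)] this assms(1)]
  show ?thesis
    using assms ess_bdd_cong_AE[OF assms(3,4)] by (auto simp: ess_pos_def)
qed

section \<open>The divergence: Bregman identities and comparison with the norm of
  \<open>L1\<close>\<close>

text \<open>The integrand is nonnegative almost everywhere and essentially bounded, so on a finite
  measure its extended integral is finite and equals the Bochner integral.\<close>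

lemma kl_div_eq_KL:
  assumes fin: "finite_measure (lebesgue_on \<Omega>)"
    and v: "ess_pos (lebesgue_on \<Omega>) v" and u: "ess_pos (lebesgue_on \<Omega>) u"
  shows "kl_div \<Omega> v u = ereal (KL (lebesgue_on \<Omega>) v u)" "0 \<le> KL (lebesgue_on \<Omega>) v u"
proof -
  let ?M = "lebesgue_on \<Omega>"
  let ?k = "\<lambda>t. v t * (ln (v t) - ln (u t)) - v t + u t"
  have nn: "AE t in ?M. 0 \<le> ?k t"
    using ess_posD(3)[OF v] ess_posD(3)[OF u]
  proof eventually_elim
    case (elim t)
    then show ?case using kl_integrand_nonneg[of "v t" "u t"] by (simp add: ln_div)
  qed
  have int: "integrable ?M ?k"
    by (intro finite_measure.integrable_ess_bdd[OF fin] ess_bdd_intros ess_posD[OF u] ess_posD[OF v])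
  have "(\<integral>\<^sup>+t. kl_integrand (v t) (u t) \<partial>?M) = (\<integral>\<^sup>+t. ennreal (?k t) \<partial>?M)"
    by (rule nn_integral_cong_AE, use ess_posD(3)[OF v] ess_posD(3)[OF u] in eventually_elim)
       (auto simp: kl_integrand_def ln_div)
  also have "\<dots> = ennreal (KL ?M v u)"
    using nn_integral_eq_integral[OF int nn] by (simp add: KL_def)
  finally show "kl_div \<Omega> v u = ereal (KL ?M v u)" "0 \<le> KL ?M v u"
    using integral_nonneg_AE[OF nn] by (simp_all add: kl_div_def KL_def)
qed

text \<open>The identity already holds pointwise between the integrands; boundedness only serves to
  split the integral.\<close>

lemma (in finite_measure) KL_three_point:
  assumes w: "ess_pos M w" and v: "ess_pos M v" and u: "ess_pos M u"
  shows "KL M w u = KL M w v + KL M v u + (LINT t|M. (ln (v t) - ln (u t)) * (w t - v t))"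
proof -
  define k where "k a b t = a t * (ln (a t) - ln (b t)) - a t + b t" for a b :: "'a \<Rightarrow> real" and t
  define j where "j t = (ln (v t) - ln (u t)) * (w t - v t)" for t
  have KL: "KL M a b = (LINT t|M. k a b t)" for a b
    by (simp add: KL_def k_def)
  have int: "integrable M (k w v)" "integrable M (k v u)" "integrable M j"
    unfolding k_def j_def
    by (intro integrable_ess_bdd ess_bdd_intros ess_posD[OF w] ess_posD[OF v] ess_posD[OF u])+
  have "k w u = (\<lambda>t. k w v t + k v u t + j t)"
    by (simp add: fun_eq_iff k_def j_def algebra_simps)
  then have "KL M w u = KL M w v + KL M v u + (LINT t|M. j t)"
    unfolding KL using int by simp
  then show ?thesis by (simp add: j_def)
qed

text \<open>This is the three-point identity with both outer functions equal to \<open>u\<close>,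
  where the left-hand side vanishes.\<close>

lemma (in finite_measure) KL_symmetric_sum:
  assumes v: "ess_pos M v" and u: "ess_pos M u"
  shows "KL M v u + KL M u v = (LINT t|M. (ln (u t) - ln (v t)) * (u t - v t))"
proof -
  have "KL M u u = 0" by (simp add: KL_def)
  moreover have "(LINT t|M. (ln (u t) - ln (v t)) * (u t - v t)) = - (LINT t|M. (ln (v t) - ln (u t)) * (u t - v t))"
    by (subst integral_minus[symmetric], rule Bochner_Integration.integral_cong) (auto simp: algebra_simps)
  ultimately show ?thesis
    using KL_three_point[OF u v u] by simp
qed

text \<open>
  The bound \<open>(\<surd>a - \<surd>b)\<^sup>2 \<le> a * ln (a / b) - a + b\<close>, followed by Young's inequality with a
  free parameter \<open>s\<close>, which replaces the Cauchy-Schwarz step in Pinsker's inequality.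
\<close>

lemma kl_lower_bound:
  fixes a b s :: real
  assumes "0 < a" "0 < b" "0 < s"
  shows "\<bar>a - b\<bar> \<le> s / 2 * (a * (ln a - ln b) - a + b) + (a + b) / s"
proof -
  define p q where "p = sqrt a" and "q = sqrt b"
  have pq: "0 < p" "0 < q" "a = p\<^sup>2" "b = q\<^sup>2"
    using assms by (auto simp: p_def q_def)
  \<comment> \<open>The logarithm inequality is applied at the quotient of the square roots: since
    \<open>ln a = 2 * ln p\<close>, it yields the full square of \<open>p - q\<close>, whereas the
    quotient \<open>b / a\<close> would give only nonnegativity.\<close>
  have "ln (q / p) \<le> q / p - 1"
    using pq by (intro ln_le_minus_one) simp
  then have "p\<^sup>2 * (2 * (ln q - ln p)) \<le> p\<^sup>2 * (2 * (q / p - 1))"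
    using pq by (intro mult_left_mono) (auto simp: ln_div)
  also have "\<dots> = 2 * p * q - 2 * p\<^sup>2"
    using pq by (simp add: field_simps power2_eq_square)
  finally have kl: "(p - q)\<^sup>2 \<le> a * (ln a - ln b) - a + b"
    using pq(1,2) unfolding pq(3,4) by (simp add: ln_realpow power2_diff algebra_simps)
  have "\<bar>a - b\<bar> = \<bar>p - q\<bar> * (p + q)"
  proof -
    have "a - b = (p - q) * (p + q)"
      using pq by (simp add: power2_eq_square algebra_simps)
    then show ?thesis using pq by (simp add: abs_mult)
  qed
  also have "\<dots> \<le> s / 2 * (p - q)\<^sup>2 + (p + q)\<^sup>2 / (2 * s)"
  proof -
    have "0 \<le> (s * \<bar>p - q\<bar> - (p + q))\<^sup>2 / (2 * s)"
      using assms by simp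
    also have "\<dots> = s / 2 * (p - q)\<^sup>2 + (p + q)\<^sup>2 / (2 * s) - \<bar>p - q\<bar> * (p + q)"
      using assms by (simp add: field_simps power2_eq_square abs_if)
    finally show ?thesis by simp
  qed
  also have "(p + q)\<^sup>2 / (2 * s) \<le> (a + b) / s"
  proof -
    have "(p + q)\<^sup>2 \<le> 2 * (a + b)"
      using pq sum_squares_bound[of p q] by (simp add: power2_sum)
    then show ?thesis
      using assms by (simp add: field_simps)
  qed
  also have "s / 2 * (p - q)\<^sup>2 \<le> s / 2 * (a * (ln a - ln b) - a + b)"
    using kl assms by (intro mult_left_mono) auto
  finally show ?thesis by simp
qed

text \<open>Integrated form of \<open>kl_lower_bound\<close>. The parameter \<open>s\<close> stays
  free so that it can be matched to a known decay of the divergence: a bound of order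
  \<open>1 / k\<close> is balanced by \<open>s = sqrt k\<close>.\<close>

lemma (in finite_measure) L1_dist_le_KL:
  assumes v: "ess_pos M v" and u: "ess_pos M u" and s: "0 < s"
  shows "(LINT t|M. \<bar>v t - u t\<bar>) \<le> s / 2 * KL M v u + ((LINT t|M. v t) + (LINT t|M. u t)) / s"
proof -
  define k where "k t = v t * (ln (v t) - ln (u t)) - v t + u t" for t
  note uv = ess_posD[OF u] ess_posD[OF v]
  have int: "integrable M k" "integrable M (\<lambda>t. v t - u t)" "integrable M v" "integrable M u"
    unfolding k_def by (intro integrable_ess_bdd ess_bdd_intros uv)+
  have "(LINT t|M. \<bar>v t - u t\<bar>) \<le> (LINT t|M. s / 2 * k t + (v t + u t) / s)"
  proof (rule integral_mono_AE)
    show "integrable M (\<lambda>t. \<bar>v t - u t\<bar>)" using int(2) by simp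
    show "integrable M (\<lambda>t. s / 2 * k t + (v t + u t) / s)" using int by simp
    show "AE t in M. \<bar>v t - u t\<bar> \<le> s / 2 * k t + (v t + u t) / s"
      unfolding k_def using uv(3) uv(6) by eventually_elim (rule kl_lower_bound[OF _ _ s])
  qed
  also have "\<dots> = s / 2 * (LINT t|M. k t) + ((LINT t|M. v t) + (LINT t|M. u t)) / s"
    using int by simp
  finally show ?thesis by (simp add: KL_def k_def)
qed

section \<open>Measurability under almost everywhere equality\<close>

text \<open>Lebesgue measure is complete; extension by zero outside \<open>S\<close> transfers this
  to the restricted space. It is needed because the recursion determines each iterate only up to a
  null set.\<close>

lemma borel_measurable_lebesgue_on_AE:
  fixes f g :: "'a::euclidean_space \<Rightarrow> real"
  assumes S: "S \<in> sets lebesgue" and f: "f \<in> borel_measurable (lebesgue_on S)"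
    and ae: "AE t in lebesgue_on S. g t = f t"
  shows "g \<in> borel_measurable (lebesgue_on S)"
proof -
  have "AE t in lebesgue. (if t \<in> S then f t else 0) = (if t \<in> S then g t else 0)"
  proof -
    have "AE t in lebesgue. t \<in> S \<longrightarrow> g t = f t"
      using ae S by (simp add: AE_restrict_space_iff)
    then show ?thesis by eventually_elim simp
  qed
  moreover have "(\<lambda>t. if t \<in> S then f t else 0) \<in> borel_measurable lebesgue"
    using f S by (simp add: borel_measurable_if)
  ultimately have "(\<lambda>t. if t \<in> S then g t else 0) \<in> borel_measurable lebesgue"
    by (rule borel_measurable_AE[rotated])
  then show ?thesis using S by (simp add: borel_measurable_if)
qed

section \<open>Convergence rate of an abstract primal-dual recursion\<close>

lemma lyapunov_rate:
  fixes d :: "nat \<Rightarrow> real" and p r :: "nat \<Rightarrow> 'y::real_inner"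
  assumes lam: "0 < lam" and d: "\<And>k. 0 \<le> d k"
    and desc: "\<And>k. d (Suc k) + lam / 2 * (norm (r k))\<^sup>2 \<le> d k"
    and p: "\<And>k. p (Suc k) = p k + lam *\<^sub>R r k"
    and pr: "\<And>k. d k \<le> - (p k \<bullet> r k)"
  shows "real k * d k \<le> ((norm (p 0))\<^sup>2 + 2 * lam * d 0) / (2 * lam)"
proof -
  \<comment> \<open>The weight \<open>2 * lam\<close> is chosen so that the term
    \<open>lam^2 * (norm (r k))^2\<close> from expanding the square of \<open>p (Suc k)\<close> is
    absorbed exactly by \<open>desc\<close>; the cross term is controlled by
    \<open>pr\<close>.\<close>
  define V where "V k = (norm (p k))\<^sup>2 + 2 * lam * d k" for k
  have V_Suc: "V (Suc k) \<le> V k - 2 * lam * d k" for k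
  proof -
    have "(norm (p (Suc k)))\<^sup>2 = (norm (p k))\<^sup>2 + 2 * lam * (p k \<bullet> r k) + lam\<^sup>2 * (norm (r k))\<^sup>2"
      unfolding p power2_norm_eq_inner
      by (simp add: inner_add_left inner_add_right inner_commute power2_eq_square algebra_simps)
    moreover have "lam * (p k \<bullet> r k) \<le> - (lam * d k)"
      using mult_left_mono[OF pr[of k], of lam] lam by simp
    moreover have "2 * lam * d (Suc k) + lam\<^sup>2 * (norm (r k))\<^sup>2 \<le> 2 * lam * d k"
      using mult_left_mono[OF desc[of k], of "2 * lam"] lam by (simp add: power2_eq_square algebra_simps)
    ultimately show ?thesis unfolding V_def by linarith
  qed
  have "antimono d"
  proof (rule decseq_SucI)
    fix k
    have "0 \<le> lam / 2 * (norm (r k))\<^sup>2" using lam by simp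
    then show "d (Suc k) \<le> d k" using desc[of k] by linarith
  qed
  then have le: "2 * lam * d (Suc k) \<le> 2 * lam * d k" for k
    using lam by (simp add: antimono_def)
  \<comment> \<open>Monotonicity bounds \<open>real (Suc k) * d (Suc k)\<close> by
    \<open>real k * d k + d k\<close>, and the extra \<open>d k\<close> is paid for by the drop of
    \<open>V\<close>. This replaces an explicit summation.\<close>
  have "2 * lam * (real k * d k) + V k \<le> V 0"
  proof (induction k)
    case (Suc k)
    have "real (Suc k) * (2 * lam * d (Suc k)) \<le> real (Suc k) * (2 * lam * d k)"
      by (intro mult_left_mono le) simp
    then show ?case using Suc V_Suc[of k] by (simp add: algebra_simps)
  qed simp
  moreover have "0 \<le> V k" unfolding V_def using lam d by simp
  ultimately show ?thesis
    using lam by (simp add: V_def field_simps)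
qed

section \<open>Link with the function classes of the statement\<close>

lemma Linf_iff_ess_bdd: "g \<in> Linf \<Omega> \<longleftrightarrow> ess_bdd (lebesgue_on \<Omega>) g"
  by (simp add: Linf_def ess_bdd_def)

text \<open>Logarithms turn the two-sided bound into boundedness of \<open>ln (u t)\<close>;
  conversely a bound \<open>B\<close> on the logarithm gives the constants \<open>exp (- B)\<close>
  and \<open>exp B\<close>. Finiteness of the measure then supplies integrability.\<close>

lemma dom_subdiff_iff_ess_pos:
  assumes "finite_measure (lebesgue_on \<Omega>)"
  shows "u \<in> dom_subdiff \<Omega> \<longleftrightarrow> ess_pos (lebesgue_on \<Omega>) u"
proof
  assume "u \<in> dom_subdiff \<Omega>"
  then obtain \<alpha> \<beta> where ab: "0 < \<alpha>" "AE t in lebesgue_on \<Omega>. \<alpha> \<le> u t \<and> u t \<le> \<beta>"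
    and u: "u \<in> borel_measurable (lebesgue_on \<Omega>)"
    by (auto simp: dom_subdiff_def L1_def)
  from ab(2) have "AE t in lebesgue_on \<Omega>. \<bar>ln (u t)\<bar> \<le> \<bar>ln \<alpha>\<bar> + \<bar>ln \<beta>\<bar>"
  proof eventually_elim
    case (elim t)
    then have "ln \<alpha> \<le> ln (u t)" "ln (u t) \<le> ln \<beta>"
      using ab(1) by (auto intro: ln_mono)
    then show ?case by linarith
  qed
  then have "ess_bdd (lebesgue_on \<Omega>) (\<lambda>t. ln (u t))"
    using u by (intro ess_bddI) auto
  moreover have "AE t in lebesgue_on \<Omega>. 0 < u t"
    using ab(2) by eventually_elim (use ab(1) in linarith)
  ultimately show "ess_pos (lebesgue_on \<Omega>) u"
    using u by (intro ess_pos_if_ln) auto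
next
  assume u: "ess_pos (lebesgue_on \<Omega>) u"
  obtain B where "AE t in lebesgue_on \<Omega>. \<bar>ln (u t)\<bar> \<le> B"
    using ess_posD(2)[OF u] by (rule ess_bddE)
  with ess_posD(3)[OF u] have "AE t in lebesgue_on \<Omega>. exp (- B) \<le> u t \<and> u t \<le> exp B"
  proof eventually_elim
    case (elim t)
    then have "exp (- B) \<le> exp (ln (u t))" "exp (ln (u t)) \<le> exp B"
      by (auto simp del: exp_ln)
    with elim show ?case by (simp del: exp_le_cancel_iff)
  qed
  then show "u \<in> dom_subdiff \<Omega>"
    using finite_measure.integrable_ess_bdd[OF assms ess_posD(1)[OF u]]
    unfolding dom_subdiff_def L1_def using exp_gt_zero[of "- B"] by blast
qed

lemma ess_pos_in_dom_f_chi: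
  assumes "finite_measure (lebesgue_on \<Omega>)" "ess_pos (lebesgue_on \<Omega>) u"
    and "m \<noteq> 0 \<Longrightarrow> (LINT t|lebesgue_on \<Omega>. u t) = 1"
  shows "u \<in> dom_f_chi \<Omega> m"
proof -
  note u = ess_posD[OF assms(2)]
  have "AE t in lebesgue_on \<Omega>. 0 \<le> u t"
    using u(3) by eventually_elim simp
  moreover have "u \<in> L1 \<Omega>" "(\<lambda>t. u t * ln (u t)) \<in> L1 \<Omega>"
    unfolding L1_def mem_Collect_eq
    by (intro finite_measure.integrable_ess_bdd[OF assms(1)] ess_bdd_intros u)+
  ultimately show ?thesis
    using assms(3) by (auto simp: dom_f_chi_def neg_entropy_def mass_indicator_def)
qed

lemma bounded_linear_L1_diff:
  assumes "bounded_linear_L1 \<Omega> A" "v \<in> L1 \<Omega>" "w \<in> L1 \<Omega>"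
  shows "A (\<lambda>t. v t - w t) = A v - A w"
proof -
  have add: "\<And>f g. f \<in> L1 \<Omega> \<Longrightarrow> g \<in> L1 \<Omega> \<Longrightarrow> A (\<lambda>t. f t + g t) = A f + A g"
    and scale: "\<And>r f. f \<in> L1 \<Omega> \<Longrightarrow> A (\<lambda>t. r * f t) = r *\<^sub>R A f"
    using assms(1) by (auto simp: bounded_linear_L1_def)
  have "(\<lambda>t. - 1 * w t) \<in> L1 \<Omega>"
    using assms(3) by (simp add: L1_def)
  from add[OF assms(2) this] show ?thesis
    unfolding scale[OF assms(3)] by simp
qed

section \<open>Convergence of the multiplicative iteration\<close>

theorem proposition4p1:
  fixes \<Omega> :: "(real^'d) set"
    and A :: "(real^'d \<Rightarrow> real) \<Rightarrow> 'y::{real_inner, complete_space}"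
    and y :: 'y
    and m :: nat
    and c lam \<gamma> :: real
    and z :: "real^'d \<Rightarrow> real"
    and u :: "nat \<Rightarrow> real^'d \<Rightarrow> real"
  assumes Omega: "open \<Omega>" "bounded \<Omega>"
    and m: "m \<in> {0, 1}"
    and c: "c > 0" and lam: "lam = 1 / c"
    and A: "bounded_linear_L1 \<Omega> A"
    and gamma: "\<gamma> > 0"
    and A_kl: "\<And>v w. v \<in> dom_f_chi \<Omega> m \<Longrightarrow> w \<in> dom_f_chi \<Omega> m \<Longrightarrow>
                 ereal (norm (A v - A w)) \<le> ereal \<gamma> * sqrt_ereal (kl_div \<Omega> v w)"
    and D_nonneg: "\<And>v w. v \<in> dom_f_chi \<Omega> m \<Longrightarrow> w \<in> dom_f_chi \<Omega> m \<inter> dom_subdiff \<Omega> \<Longrightarrow>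
                 D_functional \<Omega> A c v w \<ge> 0"
    and z: "z \<in> L1 \<Omega>" "AE t in lebesgue_on \<Omega>. z t > 0" "A z = y"
    and z_mass: "m = 1 \<Longrightarrow> mass_indicator \<Omega> m z = 0"
    and u0: "u 0 \<in> dom_subdiff \<Omega>" "(\<lambda>t. 1 + ln (u 0 t)) \<in> range_adjoint_L1 \<Omega> A"
    and u0_mass: "m = 1 \<Longrightarrow> mass_indicator \<Omega> m (u 0) = 0"
    and u_Suc: "\<And>k. AE t in lebesgue_on \<Omega>. u (Suc k) t =
                 u k t * step_factor \<Omega> A y lam m (u k) * exp (lam * adjoint_L1 \<Omega> A (y - A (u k)) t)"
    and source: "(\<lambda>t. 1 + ln (z t)) \<in> range_adjoint_L1 \<Omega> A"
  shows "(\<forall>k. kl_div \<Omega> z (u k) < \<infinity>) \<and>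
         (\<lambda>k. real_of_ereal (kl_div \<Omega> z (u k))) \<in> O(\<lambda>k. 1 / real k) \<and>
         (m = 1 \<longrightarrow> (\<lambda>k. L1_norm \<Omega> (\<lambda>t. u k t - z t)) \<in> O(\<lambda>k. 1 / sqrt (real k)))"
proof -
  let ?M = "lebesgue_on \<Omega>"
  interpret finite_measure ?M
    using Omega by (rule finite_measure_lebesgue_on_bounded)
  note fin = finite_measure_axioms
  note A_diff = bounded_linear_L1_diff[OF A]
  let ?Ad = "adjoint_L1 \<Omega> A"
  have L1_bdd: "h \<in> L1 \<Omega>" if "ess_bdd ?M h" for h
    using integrable_ess_bdd[OF that] by (simp add: L1_def)
  have Ad_bdd: "ess_bdd ?M (?Ad w)" for w
    using adjoint_L1_in_Linf[OF Omega A] by (simp add: Linf_iff_ess_bdd)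
  have Ad_inner: "(LINT t|?M. ?Ad w t * h t) = A h \<bullet> w" if "ess_bdd ?M h" for w h
    by (rule adjoint_L1_inner[OF Omega A L1_bdd[OF that]])
  have lam0: "0 < lam" using c lam by simp

  obtain w where w: "AE t in ?M. 1 + ln (z t) = ?Ad w t"
    using source by (auto simp: range_adjoint_L1_def)
  obtain w0 where w0: "AE t in ?M. 1 + ln (u 0 t) = ?Ad w0 t"
    using u0(2) by (auto simp: range_adjoint_L1_def)
  \<comment> \<open>The solution is assumed only integrable and positive; the source condition makes
    its logarithm bounded, hence \<open>z\<close> bounded and bounded away from zero.\<close>
  have z_pos: "ess_pos ?M z"
  proof (rule ess_pos_if_ln[OF _ z(2)])
    show "z \<in> borel_measurable ?M" using z(1) by (auto simp: L1_def)
    show "ess_bdd ?M (\<lambda>t. ?Ad w t - 1)" by (intro ess_bdd_intros Ad_bdd)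
    show "AE t in ?M. ln (z t) = ?Ad w t - 1" using w by eventually_elim simp
  qed
  have z_int: "(LINT t|?M. z t) = 1" if "m = 1"
    using z_mass[OF that] that by (auto simp: mass_indicator_def split: if_splits)

  \<comment> \<open>Positivity, mass and logarithms of the iterates\<close>
  define r where "r k = y - A (u k)" for k
  define f where "f k = step_factor \<Omega> A y lam m (u k)" for k
  \<comment> \<open>The premises \<open>pos\<close> and \<open>mass\<close> recur among the
    conclusions, which makes them the invariants of the induction for
    \<open>u_pos_mass\<close>.\<close>
  have step: "0 < f k \<and> ess_pos ?M (u (Suc k)) \<and> (m = 1 \<longrightarrow> (LINT t|?M. u (Suc k) t) = 1) \<and>
      (AE t in ?M. ln (u (Suc k) t) = ln (u k t) + (ln (f k) + lam * ?Ad (r k) t))"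
    if pos: "ess_pos ?M (u k)" and mass: "m = 1 \<longrightarrow> (LINT t|?M. u k t) = 1" for k
  proof -
    let ?e = "exp_step \<Omega> A y lam (u k)"
    have e_eq: "?e t = u k t * exp (lam * ?Ad (r k) t)" for t
      by (simp add: exp_step_def r_def)
    have e_bdd: "ess_bdd ?M ?e"
      unfolding e_eq[abs_def] by (intro ess_bdd_intros ess_posD[OF pos] Ad_bdd)
    have e_pos: "AE t in ?M. 0 < ?e t"
      using ess_posD(3)[OF pos] by eventually_elim (simp add: e_eq)
    then have e_nn: "AE t in ?M. 0 \<le> ?e t" by eventually_elim simp
    \<comment> \<open>Positivity almost everywhere would be vacuous on a null set; the unit mass of
      \<open>u k\<close> excludes that case and so keeps the normalising integral away from
      zero.\<close>
    have I_pos: "0 < (LINT t|?M. ?e t)" if "m = 1"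
    proof (rule ccontr)
      assume "\<not> 0 < (LINT t|?M. ?e t)"
      then have "(LINT t|?M. ?e t) = 0"
        using integral_nonneg_AE[OF e_nn] by linarith
      then have "AE t in ?M. ?e t = 0"
        using integral_nonneg_eq_0_iff_AE[OF integrable_ess_bdd[OF e_bdd] e_nn] by simp
      with e_pos have "AE t in ?M. u k t = 0"
        by eventually_elim simp
      then have "(LINT t|?M. u k t) = (LINT t|?M. 0)"
        using ess_posD(1)[OF pos] by (intro integral_cong_AE) (auto simp: ess_bdd_def)
      then show False using mass that by simp
    qed
    have f_pos: "0 < f k"
      using I_pos m by (auto simp: f_def step_factor_def)
    have u_eq: "AE t in ?M. u (Suc k) t = f k * ?e t"
      using u_Suc[of k] by eventually_elim (simp add: e_eq f_def r_def)
    have fe_bdd: "ess_bdd ?M (\<lambda>t. f k * ?e t)"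
      by (intro ess_bdd_intros e_bdd)
    have u_meas: "u (Suc k) \<in> borel_measurable ?M"
      by (rule borel_measurable_lebesgue_on_AE[OF _ ess_bdd_measurable[OF fe_bdd] u_eq])
         (use Omega in auto)
    have ln_eq: "AE t in ?M. ln (u (Suc k) t) = ln (u k t) + (ln (f k) + lam * ?Ad (r k) t)"
      using u_eq ess_posD(3)[OF pos] by eventually_elim (use f_pos in \<open>simp add: e_eq ln_mult\<close>)
    have "AE t in ?M. 0 < u (Suc k) t"
      using u_eq e_pos by eventually_elim (use f_pos in simp)
    then have "ess_pos ?M (u (Suc k))"
      by (rule ess_pos_if_ln[OF u_meas _ _ ln_eq])
         (intro ess_bdd_intros ess_posD[OF pos] Ad_bdd)
    moreover have "(LINT t|?M. u (Suc k) t) = 1" if "m = 1"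
    proof -
      have "(LINT t|?M. u (Suc k) t) = (LINT t|?M. f k * ?e t)"
        by (rule integral_cong_AE[OF u_meas ess_bdd_measurable[OF fe_bdd] u_eq])
      also have "\<dots> = f k * (LINT t|?M. ?e t)" by simp
      also have "\<dots> = 1" using I_pos[OF that] that by (simp add: f_def step_factor_def)
      finally show ?thesis .
    qed
    ultimately show ?thesis using f_pos ln_eq by blast
  qed
  have u_pos_mass: "ess_pos ?M (u k) \<and> (m = 1 \<longrightarrow> (LINT t|?M. u k t) = 1)" for k
  proof (induction k)
    case 0
    then show ?case
      using u0(1) u0_mass dom_subdiff_iff_ess_pos[OF fin]
      by (auto simp: mass_indicator_def split: if_splits)
  next
    case (Suc k)
    then show ?case using step[of k] by blast
  qed
  have u_pos: "ess_pos ?M (u k)" and u_int: "m = 1 \<Longrightarrow> (LINT t|?M. u k t) = 1" for k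
    using u_pos_mass by auto
  note u_bdd = ess_posD[OF u_pos] and z_bdd = ess_posD[OF z_pos]
  have ln_eq: "AE t in ?M. ln (u (Suc k) t) = ln (u k t) + (ln (f k) + lam * ?Ad (r k) t)" for k
    using step u_pos_mass by blast

  \<comment> \<open>Dual representation of the logarithms\<close>
  define H where "H = {h. ess_bdd ?M h \<and> (m = 1 \<longrightarrow> (LINT t|?M. h t) = 0)}"
  \<comment> \<open>Against the test functions in \<open>H\<close> the normalisation constant \<open>ln (f k)\<close> is invisible.\<close>
  have ln_step: "(LINT t|?M. (ln (u (Suc k) t) - ln (u k t)) * h t) = lam * (A h \<bullet> r k)"
    if "h \<in> H" for h k
  proof -
    have h: "ess_bdd ?M h" "m = 1 \<Longrightarrow> (LINT t|?M. h t) = 0"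
      using that by (auto simp: H_def)
    have "(LINT t|?M. (ln (u (Suc k) t) - ln (u k t)) * h t) =
        (LINT t|?M. ln (f k) * h t + lam * (?Ad (r k) t * h t))"
    proof (rule integral_cong_AE)
      show "(\<lambda>t. (ln (u (Suc k) t) - ln (u k t)) * h t) \<in> borel_measurable ?M"
        by (intro ess_bdd_measurable ess_bdd_intros u_bdd h)
      show "(\<lambda>t. ln (f k) * h t + lam * (?Ad (r k) t * h t)) \<in> borel_measurable ?M"
        by (intro ess_bdd_measurable ess_bdd_intros Ad_bdd h)
      show "AE t in ?M. (ln (u (Suc k) t) - ln (u k t)) * h t =
          ln (f k) * h t + lam * (?Ad (r k) t * h t)"
        using ln_eq[of k] by eventually_elim (simp add: algebra_simps)
    qed
    also have "\<dots> = ln (f k) * (LINT t|?M. h t) + lam * (LINT t|?M. ?Ad (r k) t * h t)"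
      using integrable_ess_bdd[OF h(1)] integrable_ess_bdd[OF ess_bdd_mult[OF Ad_bdd[of "r k"] h(1)]]
      by simp
    \<comment> \<open>The two cases differ: for \<open>m = 1\<close> the test function has mean
      zero, for \<open>m = 0\<close> the factor is \<open>1\<close> and its logarithm
      vanishes.\<close>
    also have "ln (f k) * (LINT t|?M. h t) = 0"
      using h(2) m by (auto simp: f_def step_factor_def)
    finally show ?thesis by (simp add: Ad_inner[OF h(1)])
  qed

  \<comment> \<open>The start \<open>w0 - w\<close> comes from the two source conditions, whose
    constants \<open>1\<close> cancel in the difference of logarithms. Each step then contributes
    \<open>lam *\<^sub>R r j\<close> by \<open>ln_step\<close>.\<close>
  define p where "p k = (w0 - w) + (\<Sum>j<k. lam *\<^sub>R r j)" for k
  have p_Suc: "p (Suc k) = p k + lam *\<^sub>R r k" for k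
    by (simp add: p_def)
  have ln_p: "(LINT t|?M. (ln (u k t) - ln (z t)) * h t) = A h \<bullet> p k" if "h \<in> H" for h k
  proof (induction k)
    case 0
    have h: "ess_bdd ?M h" using that by (simp add: H_def)
    have "(LINT t|?M. (ln (u 0 t) - ln (z t)) * h t) = (LINT t|?M. ?Ad w0 t * h t - ?Ad w t * h t)"
    proof (rule integral_cong_AE)
      show "(\<lambda>t. (ln (u 0 t) - ln (z t)) * h t) \<in> borel_measurable ?M"
        by (intro ess_bdd_measurable ess_bdd_intros u_bdd z_bdd h)
      show "(\<lambda>t. ?Ad w0 t * h t - ?Ad w t * h t) \<in> borel_measurable ?M"
        by (intro ess_bdd_measurable ess_bdd_intros Ad_bdd h)
      show "AE t in ?M. (ln (u 0 t) - ln (z t)) * h t = ?Ad w0 t * h t - ?Ad w t * h t"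
        using w w0
      proof eventually_elim
        case (elim t)
        then have "ln (u 0 t) - ln (z t) = ?Ad w0 t - ?Ad w t" by linarith
        then show ?case by (simp add: left_diff_distrib)
      qed
    qed
    also have "\<dots> = A h \<bullet> w0 - A h \<bullet> w"
      using integrable_ess_bdd[OF ess_bdd_mult[OF Ad_bdd[of w0] h]]
        integrable_ess_bdd[OF ess_bdd_mult[OF Ad_bdd[of w] h]]
      by (simp add: Ad_inner[OF h])
    finally show ?case by (simp add: p_def inner_diff_right)
  next
    case (Suc k)
    have h: "ess_bdd ?M h" using that by (simp add: H_def)
    have "(LINT t|?M. (ln (u (Suc k) t) - ln (z t)) * h t) =
        (LINT t|?M. (ln (u (Suc k) t) - ln (u k t)) * h t + (ln (u k t) - ln (z t)) * h t)"
      by (rule Bochner_Integration.integral_cong) (auto simp: algebra_simps)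
    also have "\<dots> = (LINT t|?M. (ln (u (Suc k) t) - ln (u k t)) * h t) +
        (LINT t|?M. (ln (u k t) - ln (z t)) * h t)"
      by (rule Bochner_Integration.integral_add)
         (intro integrable_ess_bdd ess_bdd_intros u_bdd z_bdd h)+
    also have "\<dots> = A h \<bullet> p (Suc k)"
      by (simp add: Suc.IH ln_step[OF that] p_Suc inner_add_right)
    finally show ?case .
  qed

  \<comment> \<open>Descent and the dual bound for the divergence\<close>
  define d where "d k = KL ?M z (u k)" for k
  have kl_d: "kl_div \<Omega> z (u k) = ereal (d k)" and d0: "0 \<le> d k" for k
    unfolding d_def by (rule kl_div_eq_KL[OF fin z_pos u_pos])+
  have dom: "u k \<in> dom_f_chi \<Omega> m" for k
    using u_int m by (intro ess_pos_in_dom_f_chi[OF fin u_pos]) auto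
  have desc: "d (Suc k) + lam / 2 * (norm (r k))\<^sup>2 \<le> d k" for k
  proof -
    let ?h = "\<lambda>t. z t - u (Suc k) t"
    have "?h \<in> H"
    proof -
      have "integrable ?M z" "integrable ?M (u (Suc k))"
        by (intro integrable_ess_bdd u_bdd z_bdd)+
      then have "m = 1 \<Longrightarrow> (LINT t|?M. ?h t) = 0"
        by (simp add: z_int u_int)
      moreover have "ess_bdd ?M ?h" by (intro ess_bdd_intros u_bdd z_bdd)
      ultimately show ?thesis by (simp add: H_def)
    qed
    moreover have "A ?h = r (Suc k)"
      using A_diff[OF z(1) L1_bdd[OF u_bdd(1)]] z(3) by (simp add: r_def)
    \<comment> \<open>The new iterate is the middle point of the three-point identity, so the cross
      term is the one computed by \<open>ln_step\<close> for the test function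
      \<open>z - u (Suc k)\<close>, whose image under \<open>A\<close> is
      \<open>r (Suc k)\<close>.\<close>
    ultimately have "d k = d (Suc k) + KL ?M (u (Suc k)) (u k) + lam * (r (Suc k) \<bullet> r k)"
      unfolding d_def using KL_three_point[OF z_pos u_pos[of "Suc k"] u_pos[of k]]
      by (simp add: ln_step)
    moreover have "(norm (r (Suc k) - r k))\<^sup>2 / 2 \<le> c * KL ?M (u (Suc k)) (u k)"
    proof -
      have "0 \<le> D_functional \<Omega> A c (u (Suc k)) (u k)"
        using D_nonneg dom u_pos dom_subdiff_iff_ess_pos[OF fin] by blast
      then have "(norm (A (u (Suc k)) - A (u k)))\<^sup>2 / 2 \<le> c * KL ?M (u (Suc k)) (u k)"
        by (simp add: D_functional_def kl_div_eq_KL(1)[OF fin u_pos u_pos])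
      then show ?thesis by (simp add: r_def norm_minus_commute)
    qed
    then have "lam * ((norm (r (Suc k) - r k))\<^sup>2 / 2) \<le> KL ?M (u (Suc k)) (u k)"
      using c by (simp add: lam field_simps)
    \<comment> \<open>Expanding the squared difference cancels the inner product of indefinite sign.
      What remains are two squared residuals, of which only that of \<open>r k\<close> is
      kept.\<close>
    moreover have "(norm (r (Suc k) - r k))\<^sup>2 / 2 + r (Suc k) \<bullet> r k =
        (norm (r k))\<^sup>2 / 2 + (norm (r (Suc k)))\<^sup>2 / 2"
      by (simp add: power2_norm_eq_inner inner_diff_left inner_diff_right inner_commute field_simps)
    from arg_cong[OF this, of "(*) lam"]
    have "lam * ((norm (r (Suc k) - r k))\<^sup>2 / 2) + lam * (r (Suc k) \<bullet> r k) =
        lam / 2 * (norm (r k))\<^sup>2 + lam / 2 * (norm (r (Suc k)))\<^sup>2"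
      by (simp only: distrib_left times_divide_eq_left times_divide_eq_right)
    moreover have "0 \<le> lam / 2 * (norm (r (Suc k)))\<^sup>2" using lam0 by simp
    ultimately show ?thesis by linarith
  qed
  have pr: "d k \<le> - (p k \<bullet> r k)" for k
  proof -
    let ?h = "\<lambda>t. u k t - z t"
    have "?h \<in> H"
    proof -
      have "integrable ?M z" "integrable ?M (u k)"
        by (intro integrable_ess_bdd u_bdd z_bdd)+
      then have "m = 1 \<Longrightarrow> (LINT t|?M. ?h t) = 0"
        by (simp add: z_int u_int)
      moreover have "ess_bdd ?M ?h" by (intro ess_bdd_intros u_bdd z_bdd)
      ultimately show ?thesis by (simp add: H_def)
    qed
    moreover have "A ?h = - r k"
      using A_diff[OF L1_bdd[OF u_bdd(1)] z(1)] z(3) by (simp add: r_def)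
    \<comment> \<open>Here \<open>A\<close> maps the test function to \<open>- r k\<close>, which
      explains the sign. The reverse divergence on the left is nonnegative and is dropped
      afterwards.\<close>
    ultimately have "d k + KL ?M (u k) z = - (p k \<bullet> r k)"
      unfolding d_def using KL_symmetric_sum[OF z_pos u_pos] ln_p[of ?h k]
      by (simp add: inner_commute)
    then show ?thesis using kl_div_eq_KL(2)[OF fin u_pos z_pos, of k] by linarith
  qed

  \<comment> \<open>The two rates\<close>
  define C where "C = ((norm (p 0))\<^sup>2 + 2 * lam * d 0) / (2 * lam)"
  have rate: "real k * d k \<le> C" for k
    unfolding C_def by (rule lyapunov_rate[where p = p and r = r]; fact lam0 d0 desc p_Suc pr)
  have "\<forall>k. kl_div \<Omega> z (u k) < \<infinity>" by (simp add: kl_d)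
  moreover have "(\<lambda>k. real_of_ereal (kl_div \<Omega> z (u k))) \<in> O(\<lambda>k. 1 / real k)"
  proof (rule bigoI[where c = C])
    show "\<forall>\<^sub>F k in at_top. norm (real_of_ereal (kl_div \<Omega> z (u k))) \<le> C * norm (1 / real k)"
      \<comment> \<open>Index \<open>0\<close> must be left out: \<open>1 / real 0\<close> is
        \<open>0\<close>, while \<open>d 0\<close> may be positive.\<close>
      using eventually_gt_at_top[of 0]
      by eventually_elim (use rate d0 in \<open>simp add: kl_d field_simps\<close>)
  qed
  moreover have "(\<lambda>k. L1_norm \<Omega> (\<lambda>t. u k t - z t)) \<in> O(\<lambda>k. 1 / sqrt (real k))" if "m = 1"
  \<comment> \<open>With \<open>s = sqrt (real k)\<close>, the divergence term contributes
    \<open>C / 2\<close> by \<open>rate\<close>, and the \<open>2\<close> is the sum of the unit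
    masses of \<open>z\<close> and \<open>u k\<close>.\<close>
  proof (rule bigoI[where c = "C / 2 + 2"])
    show "\<forall>\<^sub>F k in at_top. norm (L1_norm \<Omega> (\<lambda>t. u k t - z t)) \<le> (C / 2 + 2) * norm (1 / sqrt (real k))"
      using eventually_gt_at_top[of 0]
    proof eventually_elim
      case (elim k)
      define s where "s = sqrt (real k)"
      have s: "0 < s" "s * s = real k" using elim by (auto simp: s_def)
      have "L1_norm \<Omega> (\<lambda>t. u k t - z t) \<le> s / 2 * d k + 2 / s"
        using L1_dist_le_KL[OF z_pos u_pos[of k] s(1)] z_int[OF that] u_int[OF that, of k]
        by (simp add: L1_norm_def d_def abs_minus_commute)
      also have "\<dots> = (real k * d k / 2 + 2) / s"
        using s(1) by (simp add: field_simps flip: s(2))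
      also have "\<dots> \<le> (C / 2 + 2) / s"
        using rate[of k] s(1) by (intro divide_right_mono) auto
      finally have "L1_norm \<Omega> (\<lambda>t. u k t - z t) \<le> (C / 2 + 2) / s" .
      moreover have "0 \<le> L1_norm \<Omega> (\<lambda>t. u k t - z t)"
        by (simp add: L1_norm_def)
      ultimately show ?case using s(1) by (simp add: s_def)
    qed
  qed
  ultimately show ?thesis by blast
qed

end
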